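(* Let $A$ be a finite alphabet, let $X_{1:n}\in A^n$ and $Y_{1:m}\in A^m$, let $\mathrm{pen}:\mathbb N\to\mathbb R$ be a penalty function and let $D\ge 0$ be an integer. Let $V_s(X_{1:n};Y_{1:m})$ and $\sigma_0(s),\sigma_1(s),\sigma_2(s)$ be the quantities computed by the recursive algorithm described in the context. Then for any string $s$ such that $|s|\le D$, $$V_s(X_{1:n};Y_{1:m})=\max R_{(\sigma_1,\sigma_2,\sigma_0);s}(X_{1:n};Y_{1:m}),$$ where the maximum is over all admissible triples $(\sigma_0,\sigma_1,\sigma_2)$ such that $|u|+|s|\le D$ for all $u\in\sigma_1\cup\sigma_2\cup\sigma_0$. In particular, $$\widehat\sigma_{D,0}=\sigma_0(\epsilon),\qquad \widehat\sigma_{D,1}=\sigma_1(\epsilon),\qquad \widehat\sigma_{D,2}=\sigma_2(\epsilon),$$ i.e. $(\sigma_0(\epsilon),\sigma_1(\epsilon),\sigma_2(\epsilon))$ is a maximizer of $C_{n,m}(\sigma_0,\sigma_1,\sigma_2)$ over all admissible triples all of whose strings have length at most $D$.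
   Context: **Strings and trees.** $A^*=\bigcup_{n\ge 0}A^n$ is the set of finite strings over $A$, including the empty string $\epsilon$; $|s|$ is the length of $s$; $us$ is the concatenation of $u$ and $s$. For a set of strings $\sigma$, $\sigma s=\{us:u\in\sigma\}$ and $|\sigma|$ is its cardinality. A string $s'$ is a suffix of $s$ if $s=us'$ for some string $u$. A tree is a non-empty subset of $A^*$ such that no element is a suffix of another element. Its nodes are the suffixes of its elements, its leaves are its elements, and the children of a node $s$ are the nodes $as$, $a\in A$. A tree is complete if each node except the leaves has exactly $|A|$ children; $\{\epsilon\}$ is a complete tree. A triple $(\sigma_0,\sigma_1,\sigma_2)$ of finite subsets of $A^*$ (possibly empty) is admissible if $\sigma_1\cap\sigma_0=\emptyset$, $\sigma_2\cap\sigma_0=\emptyset$, and both $\sigma_1\cup\sigma_0$ and $\sigma_2\cup\sigma_0$ are complete trees. **Counts and criterion.** For $s\in A^*$, $a\in A$, $N_{n,X}(s,a)=\sum_{i=|s|+1}^n\mathbf 1_{\{X_{i-|s|:i-1}=s,\,X_i=a\}}$ and $N_{n,X}(s)=\sum_{i=|s|+1}^n\mathbf 1_{\{X_{i-|s|:i-1}=s\}}$; $N_{m,Y}(s,a)$, $N_{m,Y}(s)$ are defined in the same way from $Y_{1:m}$; empty sums are $0$. Here $\log$ is the base-2 logarithm, $0\log\frac0p=0$ and $(\frac0p)^0=1$ for every non-negative integer $p$. Let $$\begin{aligned}\ell_{n,m}(\sigma_0,\sigma_1,\sigma_2)=&\sum_{s\in\sigma_1}\sum_{a\in A}N_{n,X}(s,a)\log\frac{N_{n,X}(s,a)}{N_{n,X}(s)}+\sum_{s\in\sigma_2}\sum_{a\in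 A}N_{m,Y}(s,a)\log\frac{N_{m,Y}(s,a)}{N_{m,Y}(s)}\\&+\sum_{s\in\sigma_0}\sum_{a\in A}\left[N_{n,X}(s,a)+N_{m,Y}(s,a)\right]\log\frac{N_{n,X}(s,a)+N_{m,Y}(s,a)}{N_{n,X}(s)+N_{m,Y}(s)},\end{aligned}$$ $$C_{n,m}(\sigma_0,\sigma_1,\sigma_2)=\ell_{n,m}(\sigma_0,\sigma_1,\sigma_2)-\frac{|A|-1}{2}\Big(|\sigma_0|\,\mathrm{pen}(n+m)+|\sigma_1|\,\mathrm{pen}(n)+|\sigma_2|\,\mathrm{pen}(m)\Big).$$ $(\widehat\sigma_{D,0},\widehat\sigma_{D,1},\widehat\sigma_{D,2})$ denotes a maximizer of $C_{n,m}$ over all admissible triples with $|s|\le D$ for all $s\in\sigma_0\cup\sigma_1\cup\sigma_2$. **Local scores.** Let $$\widehat P_s(X_{1:n})=\prod_{a\in A}\left(\frac{N_{n,X}(s,a)}{N_{n,X}(s)}\right)^{N_{n,X}(s,a)},\quad \widehat P_s(Y_{1:m})=\prod_{a\in A}\left(\frac{N_{m,Y}(s,a)}{N_{m,Y}(s)}\right)^{N_{m,Y}(s,a)},$$ $$\widehat P_s(X_{1:n};Y_{1:m})=\prod_{a\in A}\left(\frac{N_{n,X}(s,a)+N_{m,Y}(s,a)}{N_{n,X}(s)+N_{m,Y}(s)}\right)^{N_{n,X}(s,a)+N_{m,Y}(s,a)}.$$ For a finite set of strings $\sigma$ (possibly empty), $$R_{\sigma;s}(X_{1:n})=\sum_{u\in\sigma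 s}\log\widehat P_u(X_{1:n})-\tfrac{|A|-1}{2}|\sigma|\,\mathrm{pen}(n),\quad R_{\sigma;s}(Y_{1:m})=\sum_{u\in\sigma s}\log\widehat P_u(Y_{1:m})-\tfrac{|A|-1}{2}|\sigma|\,\mathrm{pen}(m),$$ $$R_{\sigma;s}(X_{1:n};Y_{1:m})=\sum_{u\in\sigma s}\log\widehat P_u(X_{1:n};Y_{1:m})-\tfrac{|A|-1}{2}|\sigma|\,\mathrm{pen}(n+m),$$ $$R_{(\sigma_1,\sigma_2,\sigma_0);s}(X_{1:n};Y_{1:m})=R_{\sigma_1;s}(X_{1:n})+R_{\sigma_2;s}(Y_{1:m})+R_{\sigma_0;s}(X_{1:n};Y_{1:m}).$$ **Algorithm, step 1 (from leaves to root).** For $|s|=D$: $V_s(X_{1:n})=R_{\{\epsilon\};s}(X_{1:n})$, $\chi_s(X_{1:n})=0$; $V_s(Y_{1:m})=R_{\{\epsilon\};s}(Y_{1:m})$, $\chi_s(Y_{1:m})=0$; $$V_s(X_{1:n};Y_{1:m})=\max\{R_{\{\epsilon\};s}(X_{1:n};Y_{1:m}),\;R_{\{\epsilon\};s}(X_{1:n})+R_{\{\epsilon\};s}(Y_{1:m})\},$$ and $\chi_s(X_{1:n};Y_{1:m})=1$ if this maximum equals $R_{\{\epsilon\};s}(X_{1:n};Y_{1:m})$, and $2$ otherwise. For $|s|<D$, recursively: $V_s(X_{1:n})=\max\{R_{\{\epsilon\};s}(X_{1:n}),\ \sum_{a\in A}V_{as}(X_{1:n})\}$, with $\chi_s(X_{1:n})=0$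 if $V_s(X_{1:n})=R_{\{\epsilon\};s}(X_{1:n})$ and $1$ otherwise; $V_s(Y_{1:m})$, $\chi_s(Y_{1:m})$ are defined in the same way with $Y_{1:m}$ in place of $X_{1:n}$; and $$V_s(X_{1:n};Y_{1:m})=\max\Big\{R_{\{\epsilon\};s}(X_{1:n};Y_{1:m}),\;V_s(X_{1:n})+V_s(Y_{1:m}),\;\sum_{a\in A}V_{as}(X_{1:n};Y_{1:m})\Big\},$$ with $\chi_s(X_{1:n};Y_{1:m})=1$ if the maximum equals the first term, otherwise $2$ if it equals the second term, otherwise $3$. **Algorithm, step 2.** For $|s|\le D$: $\sigma_{X_{1:n}}(s)=\{\epsilon\}$ if $\chi_s(X_{1:n})=0$, and $\sigma_{X_{1:n}}(s)=\bigcup_{a\in A}\sigma_{X_{1:n}}(as)\,a$ if $\chi_s(X_{1:n})=1$; $\sigma_{Y_{1:m}}(s)$ is defined in the same way from $\chi_s(Y_{1:m})$. Finally: - if $\chi_s(X_{1:n};Y_{1:m})=1$: $\sigma_1(s)=\sigma_2(s)=\emptyset$, $\sigma_0(s)=\{\epsilon\}$; - if $\chi_s(X_{1:n};Y_{1:m})=2$: $\sigma_1(s)=\sigma_{X_{1:n}}(s)$, $\sigma_2(s)=\sigma_{Y_{1:m}}(s)$, $\sigma_0(s)=\emptyset$; - if $\chi_s(X_{1:n};Y_{1:m})=3$: $\sigma_i(s)=\bigcup_{a\in A}\sigma_i(as)\,a$ for $i=0,1,2$. *)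

theory Defs
  imports Complex_Main "HOL-Library.Sublist" "HOL-Library.Cardinality"
begin

text \<open>
  The alphabet is a finite type \<open>'a\<close>, strings are lists read from left to right, and a sample
  \<open>X\<^sub>1\<^sub>:\<^sub>n\<close> is a list of length \<open>n\<close>, so the sample sizes are \<open>length X\<close> and \<open>length Y\<close>.
  The string written \<open>as\<close> is \<open>a # s\<close>, and a node of a tree is extended towards the left.
\<close>

definition strcat :: "'a list set \<Rightarrow> 'a list \<Rightarrow> 'a list set" where
  "strcat \<sigma> s = {u @ s | u. u \<in> \<sigma>}"

definition is_tree :: "'a list set \<Rightarrow> bool" where
  "is_tree \<tau> \<longleftrightarrow> \<tau> \<noteq> {} \<and> (\<forall>u\<in>\<tau>. \<forall>v\<in>\<tau>. u \<noteq> v \<longrightarrow> \<not> suffix u v)"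

definition nodes :: "'a list set \<Rightarrow> 'a list set" where
  "nodes \<tau> = {v. \<exists>u\<in>\<tau>. suffix v u}"

definition children :: "'a list set \<Rightarrow> 'a list \<Rightarrow> 'a list set" where
  "children \<tau> v = {a # v | a. a # v \<in> nodes \<tau>}"

definition complete_tree :: "'a::finite list set \<Rightarrow> bool" where
  "complete_tree \<tau> \<longleftrightarrow>
     is_tree \<tau> \<and> (\<forall>v \<in> nodes \<tau> - \<tau>. card (children \<tau> v) = CARD('a))"

definition admissible :: "'a::finite list set \<Rightarrow> 'a list set \<Rightarrow> 'a list set \<Rightarrow> bool" where
  "admissible \<sigma>0 \<sigma>1 \<sigma>2 \<longleftrightarrow>
     finite \<sigma>0 \<and> finite \<sigma>1 \<and> finite \<sigma>2 \<and>
     \<sigma>1 \<inter> \<sigma>0 = {} \<and> \<sigma>2 \<inter> \<sigma>0 = {} \<and>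
     complete_tree (\<sigma>1 \<union> \<sigma>0) \<and> complete_tree (\<sigma>2 \<union> \<sigma>0)"

text \<open>Admissible triples \<open>(\<sigma>0, \<sigma>1, \<sigma>2)\<close> that may be attached below \<open>s\<close> within total depth \<open>D\<close>.\<close>

definition admissible_below ::
  "nat \<Rightarrow> 'a::finite list \<Rightarrow> ('a list set \<times> 'a list set \<times> 'a list set) set" where
  "admissible_below D s = {(\<sigma>0, \<sigma>1, \<sigma>2).
     admissible \<sigma>0 \<sigma>1 \<sigma>2 \<and> (\<forall>u \<in> \<sigma>1 \<union> \<sigma>2 \<union> \<sigma>0. length u + length s \<le> D)}"

text \<open>The substring \<open>X\<^sub>i\<^sub>:\<^sub>j\<close> with indices starting at 1; it is empty if \<open>j < i\<close>.\<close>

definition segment :: "'a list \<Rightarrow> nat \<Rightarrow> nat \<Rightarrow> 'a list" where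
  "segment X i j = map (\<lambda>k. X ! (k - 1)) [i..<Suc j]"

definition cnt2 :: "'a list \<Rightarrow> 'a list \<Rightarrow> 'a \<Rightarrow> nat" where
  "cnt2 X s a = (\<Sum>i = length s + 1..length X.
     if segment X (i - length s) (i - 1) = s \<and> X ! (i - 1) = a then 1 else 0)"

definition cnt :: "'a list \<Rightarrow> 'a list \<Rightarrow> nat" where
  "cnt X s = (\<Sum>i = length s + 1..length X.
     if segment X (i - length s) (i - 1) = s then 1 else 0)"

text \<open>
  The conventions \<open>0 log (0/p) = 0\<close> and \<open>(0/p)\<^sup>0 = 1\<close>, also for \<open>p = 0\<close>, hold for the
  HOL operations, in which \<open>x / 0 = 0\<close> and \<open>x ^ 0 = 1\<close>.
\<close>

definition loglik ::
  "'a::finite list \<Rightarrow> 'a list \<Rightarrow> 'a list set \<Rightarrow> 'a list set \<Rightarrow> 'a list set \<Rightarrow> real" where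
  "loglik X Y \<sigma>0 \<sigma>1 \<sigma>2 =
     (\<Sum>s\<in>\<sigma>1. \<Sum>a\<in>UNIV. real (cnt2 X s a) * log 2 (real (cnt2 X s a) / real (cnt X s)))
   + (\<Sum>s\<in>\<sigma>2. \<Sum>a\<in>UNIV. real (cnt2 Y s a) * log 2 (real (cnt2 Y s a) / real (cnt Y s)))
   + (\<Sum>s\<in>\<sigma>0. \<Sum>a\<in>UNIV. (real (cnt2 X s a) + real (cnt2 Y s a)) *
        log 2 ((real (cnt2 X s a) + real (cnt2 Y s a)) / (real (cnt X s) + real (cnt Y s))))"

definition criterion ::
  "(nat \<Rightarrow> real) \<Rightarrow> 'a::finite list \<Rightarrow> 'a list
     \<Rightarrow> 'a list set \<Rightarrow> 'a list set \<Rightarrow> 'a list set \<Rightarrow> real" where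
  "criterion pen X Y \<sigma>0 \<sigma>1 \<sigma>2 = loglik X Y \<sigma>0 \<sigma>1 \<sigma>2
     - (real CARD('a) - 1) / 2 *
       (real (card \<sigma>0) * pen (length X + length Y)
        + real (card \<sigma>1) * pen (length X) + real (card \<sigma>2) * pen (length Y))"

definition Phat :: "'a::finite list \<Rightarrow> 'a list \<Rightarrow> real" where
  "Phat X s = (\<Prod>a\<in>UNIV. (real (cnt2 X s a) / real (cnt X s)) ^ cnt2 X s a)"

definition Phat_joint :: "'a::finite list \<Rightarrow> 'a list \<Rightarrow> 'a list \<Rightarrow> real" where
  "Phat_joint X Y s = (\<Prod>a\<in>UNIV.
     ((real (cnt2 X s a) + real (cnt2 Y s a)) / (real (cnt X s) + real (cnt Y s)))
       ^ (cnt2 X s a + cnt2 Y s a))"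

definition R :: "(nat \<Rightarrow> real) \<Rightarrow> 'a::finite list \<Rightarrow> 'a list set \<Rightarrow> 'a list \<Rightarrow> real" where
  "R pen X \<sigma> s = (\<Sum>u \<in> strcat \<sigma> s. log 2 (Phat X u))
     - (real CARD('a) - 1) / 2 * real (card \<sigma>) * pen (length X)"

definition R_joint ::
  "(nat \<Rightarrow> real) \<Rightarrow> 'a::finite list \<Rightarrow> 'a list \<Rightarrow> 'a list set \<Rightarrow> 'a list \<Rightarrow> real" where
  "R_joint pen X Y \<sigma> s = (\<Sum>u \<in> strcat \<sigma> s. log 2 (Phat_joint X Y u))
     - (real CARD('a) - 1) / 2 * real (card \<sigma>) * pen (length X + length Y)"

definition R_triple ::
  "(nat \<Rightarrow> real) \<Rightarrow> 'a::finite list \<Rightarrow> 'a list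
     \<Rightarrow> 'a list set \<Rightarrow> 'a list set \<Rightarrow> 'a list set \<Rightarrow> 'a list \<Rightarrow> real" where
  "R_triple pen X Y \<sigma>1 \<sigma>2 \<sigma>0 s = R pen X \<sigma>1 s + R pen Y \<sigma>2 s + R_joint pen X Y \<sigma>0 s"

text \<open>
  The recursion starts at \<open>length s = D\<close>; strings longer than \<open>D\<close> are never reached by the
  algorithm and get the same (irrelevant) treatment as those of length \<open>D\<close>.
\<close>

function V :: "(nat \<Rightarrow> real) \<Rightarrow> nat \<Rightarrow> 'a::finite list \<Rightarrow> 'a list \<Rightarrow> real" where
  "V pen D X s =
     (if length s < D then max (R pen X {[]} s) (\<Sum>a\<in>UNIV. V pen D X (a # s))
      else R pen X {[]} s)"
  by pat_completeness auto
termination by (relation "measure (\<lambda>(pen, D, X, s). D - length s)") auto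

declare V.simps [simp del]

definition chi :: "(nat \<Rightarrow> real) \<Rightarrow> nat \<Rightarrow> 'a::finite list \<Rightarrow> 'a list \<Rightarrow> nat" where
  "chi pen D X s =
     (if length s < D then (if V pen D X s = R pen X {[]} s then 0 else 1) else 0)"

function V_joint ::
  "(nat \<Rightarrow> real) \<Rightarrow> nat \<Rightarrow> 'a::finite list \<Rightarrow> 'a list \<Rightarrow> 'a list \<Rightarrow> real" where
  "V_joint pen D X Y s =
     (if length s < D then
        Max {R_joint pen X Y {[]} s,
             V pen D X s + V pen D Y s,
             \<Sum>a\<in>UNIV. V_joint pen D X Y (a # s)}
      else max (R_joint pen X Y {[]} s) (R pen X {[]} s + R pen Y {[]} s))"
  by pat_completeness auto
termination by (relation "measure (\<lambda>(pen, D, X, Y, s). D - length s)") auto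

declare V_joint.simps [simp del]

definition chi_joint ::
  "(nat \<Rightarrow> real) \<Rightarrow> nat \<Rightarrow> 'a::finite list \<Rightarrow> 'a list \<Rightarrow> 'a list \<Rightarrow> nat" where
  "chi_joint pen D X Y s =
     (if length s < D then
        (if V_joint pen D X Y s = R_joint pen X Y {[]} s then 1
         else if V_joint pen D X Y s = V pen D X s + V pen D Y s then 2
         else 3)
      else (if V_joint pen D X Y s = R_joint pen X Y {[]} s then 1 else 2))"

function sigma :: "(nat \<Rightarrow> real) \<Rightarrow> nat \<Rightarrow> 'a::finite list \<Rightarrow> 'a list \<Rightarrow> 'a list set" where
  "sigma pen D X s =
     (if chi pen D X s = 0 then {[]} else (\<Union>a. strcat (sigma pen D X (a # s)) [a]))"
  by pat_completeness auto
termination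
  by (relation "measure (\<lambda>(pen, D, X, s). D - length s)")
     (auto simp: chi_def split: if_splits)

declare sigma.simps [simp del]

text \<open>\<open>sigma_joint pen D X Y i s\<close> is \<open>\<sigma>\<^sub>i(s)\<close> for \<open>i \<in> {0, 1, 2}\<close>; larger \<open>i\<close> are meaningless.\<close>

function sigma_joint ::
  "(nat \<Rightarrow> real) \<Rightarrow> nat \<Rightarrow> 'a::finite list \<Rightarrow> 'a list \<Rightarrow> nat \<Rightarrow> 'a list \<Rightarrow> 'a list set" where
  "sigma_joint pen D X Y i s =
     (if chi_joint pen D X Y s = 1 then (if i = 0 then {[]} else {})
      else if chi_joint pen D X Y s = 2 then
        (if i = 0 then {} else if i = 1 then sigma pen D X s else sigma pen D Y s)
      else (\<Union>a. strcat (sigma_joint pen D X Y i (a # s)) [a]))"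
  by pat_completeness auto
termination
  by (relation "measure (\<lambda>(pen, D, X, Y, i, s). D - length s)")
     (auto simp: chi_joint_def split: if_splits)

declare sigma_joint.simps [simp del]

text \<open>Maxima over \<open>admissible_below D s\<close> are well defined.\<close>

lemma finite_admissible_below: "finite (admissible_below D s)"
proof -
  let ?L = "{u :: 'a list. length u \<le> D}"
  have "finite ?L"
    using finite_lists_length_le[of "UNIV :: 'a set" D] by simp
  moreover have "admissible_below D s \<subseteq> Pow ?L \<times> Pow ?L \<times> Pow ?L"
    by (auto simp: admissible_below_def dest: add_leD1)
  ultimately show ?thesis
    by (meson finite_Pow_iff finite_SigmaI finite_subset)
qed

lemma admissible_below_nonempty: "length s \<le> D \<Longrightarrow> admissible_below D s \<noteq> {}"
proof -
  assume "length s \<le> D"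
  then have "({[]}, {}, {}) \<in> admissible_below D s"
    by (auto simp: admissible_below_def admissible_def complete_tree_def is_tree_def nodes_def)
  then show ?thesis by blast
qed

end

theory Submission imports Defs begin

text \<open>
  The proof is dynamic programming on trees. Apart from \<open>{\<epsilon>}\<close>, every complete tree splits at
  its root into one complete tree per letter, and conversely any such family can be grafted
  onto a common root (\<open>complete_tree_graft\<close>). A score \<open>R\<close> is a sum over leaves of a quantity that
  depends only on the full string \<open>us\<close>, penalty included, so the score of a grafted tree at \<open>s\<close>
  is the sum over the letters \<open>a\<close> of the scores of its branches at \<open>as\<close> (\<open>R_graft\<close>). Together
  these say that \<open>V\<close> satisfies the Bellman equation of the maximal score of a single tree.

  For triples the one additional observation is \<open>admissible_below_cases\<close>. If the root belongs to
  the shared part \<open>\<sigma>\<^sub>0\<close>, it is the whole triple. If it is a leaf of \<open>\<sigma>\<^sub>1\<close> or \<open>\<sigma>\<^sub>2\<close>, that tree is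
  \<open>{\<epsilon>}\<close>, so nothing can be shared: \<open>\<sigma>\<^sub>0\<close> is empty and \<open>\<sigma>\<^sub>1\<close>, \<open>\<sigma>\<^sub>2\<close> are unrelated complete trees.
  Otherwise all three parts split simultaneously into admissible triples, one per letter. These
  alternatives are bounded by the three terms of the maximum that defines \<open>V_joint\<close>, which
  gives the upper bound; following the term that attains the maximum gives the triple
  \<open>sigma_joint\<close>, whose score is exactly \<open>V_joint\<close>. Finally, at the root the score of a triple is
  the criterion, because the logarithm of a maximised likelihood is a sum of logarithms.
\<close>

section \<open>Grafting trees onto a common root\<close>

definition graft :: "('a \<Rightarrow> 'a list set) \<Rightarrow> 'a list set" where
  "graft F = (\<Union>a. strcat (F a) [a])"

definition branch :: "'a list set \<Rightarrow> 'a \<Rightarrow> 'a list set" where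
  "branch \<sigma> a = {u. u @ [a] \<in> \<sigma>}"

lemma Nil_notin_graft [simp]: "[] \<notin> graft F"
  by (auto simp: graft_def strcat_def)

lemma snoc_in_graft [simp]: "u @ [a] \<in> graft F \<longleftrightarrow> u \<in> F a"
  by (auto simp: graft_def strcat_def)

lemma ball_graft: "(\<forall>u\<in>graft F. P u) \<longleftrightarrow> (\<forall>a. \<forall>u\<in>F a. P (u @ [a]))"
  by (auto simp: graft_def strcat_def)

lemma bex_graft: "(\<exists>u\<in>graft F. P u) \<longleftrightarrow> (\<exists>a. \<exists>u\<in>F a. P (u @ [a]))"
  by (auto simp: graft_def strcat_def)

lemma graft_branch:
  assumes "[] \<notin> \<sigma>"
  shows "graft (branch \<sigma>) = \<sigma>"
proof (rule set_eqI)
  fix u show "u \<in> graft (branch \<sigma>) \<longleftrightarrow> u \<in> \<sigma>"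
    using assms by (cases u rule: rev_cases) (auto simp: branch_def)
qed

lemma graft_Un: "graft F \<union> graft G = graft (\<lambda>a. F a \<union> G a)"
  by (auto simp: graft_def strcat_def)

lemma graft_Int_empty: "graft F \<inter> graft G = {} \<longleftrightarrow> (\<forall>a. F a \<inter> G a = {})"
  by (auto simp: graft_def strcat_def)

lemma finite_graft:
  fixes F :: "'a::finite \<Rightarrow> 'a list set"
  shows "finite (graft F) \<longleftrightarrow> (\<forall>a. finite (F a))"
proof -
  have eq: "strcat (F a) [a] = (\<lambda>u. u @ [a]) ` F a" for a
    by (auto simp: strcat_def)
  have "finite (strcat (F a) [a]) \<longleftrightarrow> finite (F a)" for a
    unfolding eq by (rule finite_image_iff) (auto simp: inj_on_def)
  then show ?thesis by (simp add: graft_def)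
qed

lemma sum_graft:
  fixes F :: "'a::finite \<Rightarrow> 'a list set" and g :: "'a list \<Rightarrow> 'b::comm_monoid_add"
  assumes "\<And>a. finite (F a)"
  shows "sum g (graft F) = (\<Sum>a\<in>UNIV. \<Sum>u\<in>F a. g (u @ [a]))"
proof -
  have "graft F = (\<Union>a. (\<lambda>u. u @ [a]) ` F a)"
    by (auto simp: graft_def strcat_def)
  then have "sum g (graft F) = (\<Sum>a\<in>UNIV. sum g ((\<lambda>u. u @ [a]) ` F a))"
    using assms by (simp only:) (subst sum.UNION_disjoint, auto)
  moreover have "sum g ((\<lambda>u. u @ [a]) ` F a) = (\<Sum>u\<in>F a. g (u @ [a]))" for a
    by (subst sum.reindex) (auto simp: inj_on_def)
  ultimately show ?thesis by simp
qed

section \<open>Complete trees\<close>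

lemma complete_tree_iff:
  fixes \<tau> :: "'a::finite list set"
  shows "complete_tree \<tau> \<longleftrightarrow> is_tree \<tau> \<and> (\<forall>v\<in>nodes \<tau> - \<tau>. \<forall>a. a # v \<in> nodes \<tau>)"
proof -
  have "card (children \<tau> v) = CARD('a) \<longleftrightarrow> (\<forall>a. a # v \<in> nodes \<tau>)" for v
  proof -
    have "children \<tau> v = (\<lambda>a. a # v) ` {a. a # v \<in> nodes \<tau>}"
      by (auto simp: children_def)
    then have "card (children \<tau> v) = card {a. a # v \<in> nodes \<tau>}"
      by (simp add: card_image inj_on_def)
    also have "\<dots> = CARD('a) \<longleftrightarrow> {a. a # v \<in> nodes \<tau>} = UNIV"
      using card_subset_eq[of "UNIV :: 'a set" "{a. a # v \<in> nodes \<tau>}"] by auto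
    finally show ?thesis by auto
  qed
  then show ?thesis by (simp add: complete_tree_def)
qed

lemma complete_tree_root: "complete_tree {[]}"
  by (auto simp: complete_tree_def is_tree_def nodes_def)

text \<open>The empty string is a suffix of every string, so it cannot share a tree with another leaf.\<close>

lemma tree_with_root_leaf:
  assumes "complete_tree \<tau>" "[] \<in> \<tau>"
  shows "\<tau> = {[]}"
proof -
  have "u = []" if "u \<in> \<tau>" for u
    using assms that by (fastforce simp: complete_tree_def is_tree_def)
  with assms(2) show ?thesis by blast
qed

lemma Nil_in_nodes [simp]: "[] \<in> nodes \<tau> \<longleftrightarrow> \<tau> \<noteq> {}"
  by (auto simp: nodes_def)

lemma snoc_in_nodes_graft [simp]: "v @ [a] \<in> nodes (graft F) \<longleftrightarrow> v \<in> nodes (F a)"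
  by (simp add: nodes_def bex_graft)

lemma is_tree_graft:
  assumes "\<And>a. F a \<noteq> {}"
  shows "is_tree (graft F) \<longleftrightarrow> (\<forall>a. is_tree (F a))"
proof -
  have "graft F \<noteq> {}"
    using assms by (auto simp: graft_def strcat_def)
  moreover have "(\<forall>u\<in>graft F. \<forall>v\<in>graft F. u \<noteq> v \<longrightarrow> \<not> suffix u v) \<longleftrightarrow>
      (\<forall>a. \<forall>u\<in>F a. \<forall>v\<in>F a. u \<noteq> v \<longrightarrow> \<not> suffix u v)"
    unfolding ball_graft by auto
  ultimately show ?thesis
    using assms by (simp add: is_tree_def)
qed

text \<open>
  No branch of a complete grafted tree is empty: the root is an inner node, so all
  its children are nodes. Below the root, nodes and children correspond branch by branch.
\<close>

lemma complete_tree_graft: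
  fixes F :: "'a::finite \<Rightarrow> 'a list set"
  shows "complete_tree (graft F) \<longleftrightarrow> (\<forall>a. complete_tree (F a))"
proof (cases "\<forall>a. F a \<noteq> {}")
  case True
  then have ne: "graft F \<noteq> {}"
    by (auto simp: graft_def strcat_def)
  have child_root: "[a] \<in> nodes (graft F)" for a
    using snoc_in_nodes_graft[of "[]" a F] True by simp
  have child: "b # v @ [a] \<in> nodes (graft F) \<longleftrightarrow> b # v \<in> nodes (F a)" for a b v
    using snoc_in_nodes_graft[of "b # v" a F] by simp
  have "(\<forall>v\<in>nodes (graft F) - graft F. \<forall>b. b # v \<in> nodes (graft F)) \<longleftrightarrow>
      (\<forall>a. \<forall>v\<in>nodes (F a) - F a. \<forall>b. b # v \<in> nodes (F a))" (is "?L \<longleftrightarrow> ?R")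
  proof
    assume L: ?L
    show ?R
    proof (intro allI ballI)
      fix a v b assume "v \<in> nodes (F a) - F a"
      then have "v @ [a] \<in> nodes (graft F) - graft F" by simp
      with L show "b # v \<in> nodes (F a)" using child by blast
    qed
  next
    assume R: ?R
    show ?L
    proof (intro allI ballI)
      fix v b assume v: "v \<in> nodes (graft F) - graft F"
      show "b # v \<in> nodes (graft F)"
      proof (cases v rule: rev_cases)
        case Nil then show ?thesis by (simp add: child_root)
      next
        case (snoc w a) then show ?thesis using v R child by simp
      qed
    qed
  qed
  then show ?thesis
    using True by (auto simp: complete_tree_iff is_tree_graft)
next
  case False
  then obtain a where a: "F a = {}" by blast
  then have "\<not> complete_tree (F a)"
    by (simp add: complete_tree_def is_tree_def)
  moreover have "\<not> complete_tree (graft F)"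
  proof
    assume c: "complete_tree (graft F)"
    then have "[] \<in> nodes (graft F) - graft F"
      by (simp add: complete_tree_def is_tree_def)
    with c have "[] @ [a] \<in> nodes (graft F)"
      by (auto simp: complete_tree_iff)
    then show False
      using a by (simp only: snoc_in_nodes_graft) simp
  qed
  ultimately show ?thesis by blast
qed

definition trees_below :: "nat \<Rightarrow> 'a::finite list \<Rightarrow> 'a list set set" where
  "trees_below D s = {\<tau>. finite \<tau> \<and> complete_tree \<tau> \<and> (\<forall>u\<in>\<tau>. length u + length s \<le> D)}"

lemma root_in_trees_below: "length s \<le> D \<Longrightarrow> {[]} \<in> trees_below D s"
  by (simp add: trees_below_def complete_tree_root)

lemma trees_below_root_leaf: "\<tau> \<in> trees_below D s \<Longrightarrow> [] \<in> \<tau> \<Longrightarrow> \<tau> = {[]}"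
  by (rule tree_with_root_leaf) (simp_all add: trees_below_def)

lemma graft_in_trees_below:
  "graft F \<in> trees_below D s \<longleftrightarrow> (\<forall>a. F a \<in> trees_below D (a # s))"
  by (auto simp: trees_below_def finite_graft complete_tree_graft ball_graft)

lemma trees_below_cases:
  assumes "\<tau> \<in> trees_below D s"
  obtains (root) "\<tau> = {[]}"
  | (graft) F where "\<tau> = graft F" "length s < D" "\<And>a. F a \<in> trees_below D (a # s)"
proof (cases "[] \<in> \<tau>")
  case True
  then show ?thesis
    by (rule root[OF trees_below_root_leaf[OF assms]])
next
  case False
  then have eq: "graft (branch \<tau>) = \<tau>" by (rule graft_branch)
  obtain u where "u \<in> \<tau>"
    using assms by (auto simp: trees_below_def complete_tree_def is_tree_def)
  with False assms have "u \<noteq> []" "length u + length s \<le> D"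
    by (auto simp: trees_below_def)
  then have "length s < D" by (cases u) auto
  moreover have "branch \<tau> a \<in> trees_below D (a # s)" for a
    using assms eq graft_in_trees_below by metis
  ultimately show ?thesis
    by (rule graft[OF eq[symmetric]])
qed

section \<open>Admissible triples\<close>

lemma admissible_below_iff:
  "(\<sigma>0, \<sigma>1, \<sigma>2) \<in> admissible_below D s \<longleftrightarrow>
     \<sigma>1 \<inter> \<sigma>0 = {} \<and> \<sigma>2 \<inter> \<sigma>0 = {} \<and>
     \<sigma>1 \<union> \<sigma>0 \<in> trees_below D s \<and> \<sigma>2 \<union> \<sigma>0 \<in> trees_below D s"
  by (simp add: admissible_below_def admissible_def trees_below_def ball_Un) blast

lemma admissible_below_finite:
  assumes "(\<sigma>0, \<sigma>1, \<sigma>2) \<in> admissible_below D s"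
  shows "finite \<sigma>0" "finite \<sigma>1" "finite \<sigma>2"
  using assms by (auto simp: admissible_below_def admissible_def)

lemma graft_in_admissible_below:
  "(graft F0, graft F1, graft F2) \<in> admissible_below D s \<longleftrightarrow>
     (\<forall>a. (F0 a, F1 a, F2 a) \<in> admissible_below D (a # s))"
  by (simp add: admissible_below_iff graft_Un graft_Int_empty graft_in_trees_below
      all_conj_distrib)

lemma separate_in_admissible_below:
  "({}, \<sigma>1, \<sigma>2) \<in> admissible_below D s \<longleftrightarrow> \<sigma>1 \<in> trees_below D s \<and> \<sigma>2 \<in> trees_below D s"
  by (simp add: admissible_below_iff)

text \<open>
  The alternatives are told apart by the part that contains the empty string. If it lies in
  \<open>\<sigma>\<^sub>1\<close>, then \<open>\<sigma>\<^sub>1 \<union> \<sigma>\<^sub>0 = {\<epsilon>}\<close>, and disjointness leaves nothing for \<open>\<sigma>\<^sub>0\<close>; likewise for \<open>\<sigma>\<^sub>2\<close>.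
\<close>

lemma admissible_below_cases:
  assumes adm: "(\<sigma>0, \<sigma>1, \<sigma>2) \<in> admissible_below D s"
  obtains (shared) "\<sigma>0 = {[]}" "\<sigma>1 = {}" "\<sigma>2 = {}"
  | (separate) "\<sigma>0 = {}" "\<sigma>1 \<in> trees_below D s" "\<sigma>2 \<in> trees_below D s"
  | (graft) F0 F1 F2 where "\<sigma>0 = graft F0" "\<sigma>1 = graft F1" "\<sigma>2 = graft F2" "length s < D"
      "\<And>a. (F0 a, F1 a, F2 a) \<in> admissible_below D (a # s)"
proof -
  have disj: "\<sigma>1 \<inter> \<sigma>0 = {}" "\<sigma>2 \<inter> \<sigma>0 = {}"
    and trees: "\<sigma>1 \<union> \<sigma>0 \<in> trees_below D s" "\<sigma>2 \<union> \<sigma>0 \<in> trees_below D s"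
    using adm by (simp_all add: admissible_below_iff)
  note root1 = trees_below_root_leaf[OF trees(1)]
  note root2 = trees_below_root_leaf[OF trees(2)]
  consider "[] \<in> \<sigma>0" | "[] \<in> \<sigma>1 \<union> \<sigma>2" "[] \<notin> \<sigma>0" | "[] \<notin> \<sigma>0 \<union> \<sigma>1 \<union> \<sigma>2" by blast
  then show ?thesis
  proof cases
    case 1
    then have "\<sigma>1 \<union> \<sigma>0 = {[]}" "\<sigma>2 \<union> \<sigma>0 = {[]}"
      by (simp_all add: root1 root2)
    then have "\<sigma>0 \<subseteq> {[]}" "\<sigma>1 \<subseteq> {[]}" "\<sigma>2 \<subseteq> {[]}"
      by auto
    with 1 disj have "\<sigma>0 = {[]}" "\<sigma>1 = {}" "\<sigma>2 = {}"
      by auto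
    then show ?thesis by (rule shared)
  next
    case 2
    have "\<sigma>1 \<union> \<sigma>0 = {[]} \<or> \<sigma>2 \<union> \<sigma>0 = {[]}"
      using 2(1) root1 root2 by (elim UnE) simp_all
    then have "\<sigma>0 \<subseteq> {[]}" by auto
    with 2 have "\<sigma>0 = {}" by auto
    then show ?thesis using separate trees by simp
  next
    case 3
    then have eq: "graft (branch \<sigma>0) = \<sigma>0" "graft (branch \<sigma>1) = \<sigma>1" "graft (branch \<sigma>2) = \<sigma>2"
      by (simp_all add: graft_branch)
    have "length s < D"
      using trees(1) 3 by (cases rule: trees_below_cases) auto
    moreover have "(branch \<sigma>0 a, branch \<sigma>1 a, branch \<sigma>2 a) \<in> admissible_below D (a # s)" for a
      using adm graft_in_admissible_below[of "branch \<sigma>0" "branch \<sigma>1" "branch \<sigma>2" D s]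
      by (simp add: eq)
    ultimately show ?thesis
      by (rule graft[OF eq(1)[symmetric] eq(2)[symmetric] eq(3)[symmetric]])
  qed
qed

section \<open>Additivity of the scores\<close>

lemma sum_strcat: "sum g (strcat \<sigma> s) = (\<Sum>u\<in>\<sigma>. g (u @ s))"
proof -
  have "strcat \<sigma> s = (\<lambda>u. u @ s) ` \<sigma>"
    by (auto simp: strcat_def)
  then show ?thesis
    by (simp add: sum.reindex inj_on_def)
qed

text \<open>
  The penalty is linear in the number of leaves, so it can be charged leaf by leaf; each leaf then
  contributes the score of the one-leaf tree at its full string.
\<close>

lemma R_eq_sum: "R pen X \<sigma> s = (\<Sum>u\<in>\<sigma>. R pen X {[]} (u @ s))"
  by (simp add: R_def sum_strcat sum_subtractf)

lemma R_joint_eq_sum: "R_joint pen X Y \<sigma> s = (\<Sum>u\<in>\<sigma>. R_joint pen X Y {[]} (u @ s))"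
  by (simp add: R_joint_def sum_strcat sum_subtractf)

lemma R_empty [simp]: "R pen X {} s = 0"
  by (subst R_eq_sum) simp

lemma R_joint_empty [simp]: "R_joint pen X Y {} s = 0"
  by (subst R_joint_eq_sum) simp

lemma R_graft:
  assumes "\<And>a. finite (F a)"
  shows "R pen X (graft F) s = (\<Sum>a\<in>UNIV. R pen X (F a) (a # s))"
  by (subst (1 2) R_eq_sum) (simp add: sum_graft assms)

lemma R_joint_graft:
  assumes "\<And>a. finite (F a)"
  shows "R_joint pen X Y (graft F) s = (\<Sum>a\<in>UNIV. R_joint pen X Y (F a) (a # s))"
  by (subst (1 2) R_joint_eq_sum) (simp add: sum_graft assms)

lemma R_triple_graft:
  assumes "\<And>a. (F0 a, F1 a, F2 a) \<in> admissible_below D (a # s)"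
  shows "R_triple pen X Y (graft F1) (graft F2) (graft F0) s =
    (\<Sum>a\<in>UNIV. R_triple pen X Y (F1 a) (F2 a) (F0 a) (a # s))"
  using admissible_below_finite[OF assms]
  by (simp add: R_triple_def R_graft R_joint_graft sum.distrib)

section \<open>Optimality of the recursion for a single sample\<close>

lemma leaves_to_root_induct [consumes 1, case_names step]:
  fixes s :: "'a list"
  assumes "length s \<le> D"
    and step: "\<And>s. length s \<le> D \<Longrightarrow> (\<And>a. length s < D \<Longrightarrow> P (a # s)) \<Longrightarrow> P s"
  shows "P s"
  using assms(1)
proof (induction "D - length s" arbitrary: s rule: less_induct)
  case less
  show ?case
    by (rule step) (use less in auto)
qed

lemma R_le_V:
  assumes "length s \<le> D" "\<tau> \<in> trees_below D s"
  shows "R pen X \<tau> s \<le> V pen D X s"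
  using assms
proof (induction s arbitrary: \<tau> rule: leaves_to_root_induct)
  case (step s)
  from step.prems show ?case
  proof (cases rule: trees_below_cases)
    case root
    then show ?thesis by (subst V.simps) simp
  next
    case (graft F)
    have "R pen X \<tau> s = (\<Sum>a\<in>UNIV. R pen X (F a) (a # s))"
      using graft by (simp add: R_graft trees_below_def)
    also have "\<dots> \<le> (\<Sum>a\<in>UNIV. V pen D X (a # s))"
      using graft by (intro sum_mono step.IH) auto
    also have "\<dots> \<le> V pen D X s"
      using graft by (subst (2) V.simps) simp
    finally show ?thesis .
  qed
qed

lemma sigma_attains_V:
  assumes "length s \<le> D"
  shows "sigma pen D X s \<in> trees_below D s \<and> R pen X (sigma pen D X s) s = V pen D X s"
  using assms
proof (induction s rule: leaves_to_root_induct)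
  case (step s)
  show ?case
  proof (cases "chi pen D X s = 0")
    case True
    then have "sigma pen D X s = {[]}"
      by (subst sigma.simps) simp
    moreover have "V pen D X s = R pen X {[]} s"
      using True by (subst V.simps) (auto simp: chi_def V.simps[of pen D X s] split: if_splits)
    ultimately show ?thesis
      using step.hyps by (simp add: root_in_trees_below)
  next
    case False
    then have less: "length s < D" and ne: "V pen D X s \<noteq> R pen X {[]} s"
      by (auto simp: chi_def split: if_splits)
    let ?F = "\<lambda>a. sigma pen D X (a # s)"
    have sigma: "sigma pen D X s = graft ?F"
      using False by (subst sigma.simps) (simp add: graft_def)
    have "R pen X (graft ?F) s = (\<Sum>a\<in>UNIV. V pen D X (a # s))"
      using step.IH[OF less] by (simp add: R_graft trees_below_def)
    also have "\<dots> = V pen D X s"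
      using ne less by (simp add: V.simps[of pen D X s] max_def split: if_splits)
    finally show ?thesis
      using step.IH[OF less] by (simp add: sigma graft_in_trees_below)
  qed
qed

section \<open>Optimality of the recursion for two samples\<close>

text \<open>
  At depth \<open>D\<close> the single-sample values are the scores of the root, so the second term has
  the same form at every depth.
\<close>

lemma V_joint_eq:
  "V_joint pen D X Y s =
     (if length s < D then
        Max {R_joint pen X Y {[]} s, V pen D X s + V pen D Y s,
             \<Sum>a\<in>UNIV. V_joint pen D X Y (a # s)}
      else max (R_joint pen X Y {[]} s) (V pen D X s + V pen D Y s))"
  by (subst V_joint.simps) (simp add: V.simps[of pen D _ s])

lemma R_triple_le_V_joint:
  assumes "length s \<le> D" "(\<sigma>0, \<sigma>1, \<sigma>2) \<in> admissible_below D s"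
  shows "R_triple pen X Y \<sigma>1 \<sigma>2 \<sigma>0 s \<le> V_joint pen D X Y s"
  using assms
proof (induction s arbitrary: \<sigma>0 \<sigma>1 \<sigma>2 rule: leaves_to_root_induct)
  case (step s)
  from step.prems show ?case
  proof (cases rule: admissible_below_cases)
    case shared
    then show ?thesis
      by (subst V_joint_eq) (simp add: R_triple_def)
  next
    case separate
    then have "R_triple pen X Y \<sigma>1 \<sigma>2 \<sigma>0 s \<le> V pen D X s + V pen D Y s"
      using step.hyps by (simp add: R_triple_def add_mono R_le_V)
    also have "\<dots> \<le> V_joint pen D X Y s"
      by (subst V_joint_eq) (simp add: le_max_iff_disj)
    finally show ?thesis .
  next
    case (graft F0 F1 F2)
    have "R_triple pen X Y \<sigma>1 \<sigma>2 \<sigma>0 s =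
        (\<Sum>a\<in>UNIV. R_triple pen X Y (F1 a) (F2 a) (F0 a) (a # s))"
      unfolding graft(1-3) by (rule R_triple_graft) (rule graft(5))
    also have "\<dots> \<le> (\<Sum>a\<in>UNIV. V_joint pen D X Y (a # s))"
      using graft by (intro sum_mono step.IH) auto
    also have "\<dots> \<le> V_joint pen D X Y s"
      using graft by (subst (2) V_joint_eq) simp
    finally show ?thesis .
  qed
qed

lemma sigma_joint_attains_V_joint:
  assumes "length s \<le> D"
  shows "(sigma_joint pen D X Y 0 s, sigma_joint pen D X Y 1 s, sigma_joint pen D X Y 2 s)
           \<in> admissible_below D s \<and>
         R_triple pen X Y (sigma_joint pen D X Y 1 s) (sigma_joint pen D X Y 2 s)
           (sigma_joint pen D X Y 0 s) s = V_joint pen D X Y s"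
  using assms
proof (induction s rule: leaves_to_root_induct)
  case (step s)
  consider (shared) "chi_joint pen D X Y s = 1" | (separate) "chi_joint pen D X Y s = 2"
    | (graft) "chi_joint pen D X Y s \<noteq> 1" "chi_joint pen D X Y s \<noteq> 2"
    by blast
  then show ?case
  proof cases
    case shared
    then have "V_joint pen D X Y s = R_joint pen X Y {[]} s"
      by (auto simp: chi_joint_def split: if_splits)
    then show ?thesis
      using shared step.hyps
      by (simp add: sigma_joint.simps[of pen D X Y _ s] R_triple_def admissible_below_iff
          root_in_trees_below)
  next
    case separate
    then have "V_joint pen D X Y s = V pen D X s + V pen D Y s"
      by (auto simp: chi_joint_def V_joint_eq[of pen D X Y s] max_def split: if_splits)
    then show ?thesis
      using separate sigma_attains_V[OF step.hyps]
      by (simp add: sigma_joint.simps[of pen D X Y _ s] R_triple_def separate_in_admissible_below)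
  next
    case graft
    then have less: "length s < D" and ne: "V_joint pen D X Y s \<noteq> R_joint pen X Y {[]} s"
        "V_joint pen D X Y s \<noteq> V pen D X s + V pen D Y s"
      by (auto simp: chi_joint_def split: if_splits)
    let ?F = "\<lambda>i a. sigma_joint pen D X Y i (a # s)"
    have sigma: "sigma_joint pen D X Y i s = graft (?F i)" for i
      using graft by (subst sigma_joint.simps) (simp add: graft_def)
    have adm: "(?F 0 a, ?F 1 a, ?F 2 a) \<in> admissible_below D (a # s)" for a
      using step.IH[OF less] by blast
    have "V_joint pen D X Y s \<in> {R_joint pen X Y {[]} s, V pen D X s + V pen D Y s,
        \<Sum>a\<in>UNIV. V_joint pen D X Y (a # s)}"
      using less by (subst V_joint_eq) (simp add: max_def)
    with ne have "V_joint pen D X Y s = (\<Sum>a\<in>UNIV. V_joint pen D X Y (a # s))"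
      by blast
    also have "\<dots> = (\<Sum>a\<in>UNIV. R_triple pen X Y (?F 1 a) (?F 2 a) (?F 0 a) (a # s))"
      using step.IH[OF less] by simp
    also have "\<dots> = R_triple pen X Y (graft (?F 1)) (graft (?F 2)) (graft (?F 0)) s"
      by (rule R_triple_graft[OF adm, symmetric])
    finally show ?thesis
      using adm by (simp add: sigma graft_in_admissible_below)
  qed
qed

lemma V_joint_eq_Max:
  assumes "length s \<le> D"
  shows "V_joint pen D X Y s =
    Max ((\<lambda>(\<sigma>0, \<sigma>1, \<sigma>2). R_triple pen X Y \<sigma>1 \<sigma>2 \<sigma>0 s) ` admissible_below D s)"
proof (rule sym, rule Max_eqI)
  show "finite ((\<lambda>(\<sigma>0, \<sigma>1, \<sigma>2). R_triple pen X Y \<sigma>1 \<sigma>2 \<sigma>0 s) ` admissible_below D s)"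
    by (simp add: finite_admissible_below)
  show "r \<le> V_joint pen D X Y s"
    if "r \<in> (\<lambda>(\<sigma>0, \<sigma>1, \<sigma>2). R_triple pen X Y \<sigma>1 \<sigma>2 \<sigma>0 s) ` admissible_below D s" for r
    using that R_triple_le_V_joint[OF assms] by auto
  show "V_joint pen D X Y s \<in>
      (\<lambda>(\<sigma>0, \<sigma>1, \<sigma>2). R_triple pen X Y \<sigma>1 \<sigma>2 \<sigma>0 s) ` admissible_below D s"
    using sigma_joint_attains_V_joint[OF assms, of pen X Y] by (force simp: image_iff)
qed

section \<open>The criterion as the score at the root\<close>

lemma cnt2_le_cnt: "cnt2 X s a \<le> cnt X s"
  unfolding cnt2_def cnt_def by (rule sum_mono) simp

text \<open>
  The logarithm of a product is a sum only if no factor vanishes. Here a factor with positive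
  exponent \<open>k a\<close> has a positive base, since \<open>k a \<le> N\<close>, and a factor with exponent \<open>0\<close> equals \<open>1\<close>.
\<close>

lemma log_likelihood:
  fixes k :: "'a::finite \<Rightarrow> nat"
  assumes "\<And>a. k a \<le> N"
  shows "log 2 (\<Prod>a\<in>UNIV. (real (k a) / real N) ^ k a) =
    (\<Sum>a\<in>UNIV. real (k a) * log 2 (real (k a) / real N))"
proof -
  have nonzero: "(real (k a) / real N) ^ k a \<noteq> 0" for a
    using assms[of a] by (cases "k a = 0") auto
  have "log 2 ((real (k a) / real N) ^ k a) = real (k a) * log 2 (real (k a) / real N)" for a
    using assms[of a] by (cases "k a = 0") (auto simp: log_nat_power)
  moreover have "log 2 (\<Prod>a\<in>UNIV. (real (k a) / real N) ^ k a) =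
      (\<Sum>a\<in>UNIV. log 2 ((real (k a) / real N) ^ k a))"
    unfolding log_def sum_divide_distrib[symmetric] by (subst ln_prod[OF _ nonzero]) auto
  ultimately show ?thesis by simp
qed

lemma log_Phat:
  "log 2 (Phat X s) =
    (\<Sum>a\<in>UNIV. real (cnt2 X s a) * log 2 (real (cnt2 X s a) / real (cnt X s)))"
  unfolding Phat_def by (rule log_likelihood) (rule cnt2_le_cnt)

lemma log_Phat_joint:
  "log 2 (Phat_joint X Y s) =
    (\<Sum>a\<in>UNIV. (real (cnt2 X s a) + real (cnt2 Y s a)) *
        log 2 ((real (cnt2 X s a) + real (cnt2 Y s a)) / (real (cnt X s) + real (cnt Y s))))"
  using log_likelihood[of "\<lambda>a. cnt2 X s a + cnt2 Y s a" "cnt X s + cnt Y s"]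
  by (simp add: Phat_joint_def add_mono cnt2_le_cnt)

lemma criterion_eq_R_triple: "criterion pen X Y \<sigma>0 \<sigma>1 \<sigma>2 = R_triple pen X Y \<sigma>1 \<sigma>2 \<sigma>0 []"
  by (simp add: criterion_def loglik_def R_triple_def R_def R_joint_def sum_strcat
      log_Phat log_Phat_joint algebra_simps)

section \<open>Correctness of the algorithm\<close>

theorem proposition1:
  fixes X Y :: "'a::finite list" and pen :: "nat \<Rightarrow> real" and D :: nat
  shows "(\<forall>s. length s \<le> D \<longrightarrow>
            V_joint pen D X Y s =
              Max ((\<lambda>(\<sigma>0, \<sigma>1, \<sigma>2). R_triple pen X Y \<sigma>1 \<sigma>2 \<sigma>0 s) ` admissible_below D s))
       \<and> is_arg_max
            (\<lambda>(\<sigma>0, \<sigma>1, \<sigma>2). criterion pen X Y \<sigma>0 \<sigma>1 \<sigma>2)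
            (\<lambda>(\<sigma>0, \<sigma>1, \<sigma>2). admissible \<sigma>0 \<sigma>1 \<sigma>2 \<and> (\<forall>u \<in> \<sigma>0 \<union> \<sigma>1 \<union> \<sigma>2. length u \<le> D))
            (sigma_joint pen D X Y 0 [], sigma_joint pen D X Y 1 [], sigma_joint pen D X Y 2 [])"
proof (intro conjI allI impI)
  fix s :: "'a list" assume "length s \<le> D"
  then show "V_joint pen D X Y s =
      Max ((\<lambda>(\<sigma>0, \<sigma>1, \<sigma>2). R_triple pen X Y \<sigma>1 \<sigma>2 \<sigma>0 s) ` admissible_below D s)"
    by (rule V_joint_eq_Max)
next
  have below_root: "admissible \<sigma>0 \<sigma>1 \<sigma>2 \<and> (\<forall>u \<in> \<sigma>0 \<union> \<sigma>1 \<union> \<sigma>2. length u \<le> D) \<longleftrightarrow>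
      (\<sigma>0, \<sigma>1, \<sigma>2) \<in> admissible_below D []" for \<sigma>0 \<sigma>1 \<sigma>2 :: "'a list set"
    by (auto simp: admissible_below_def)
  have attains: "(sigma_joint pen D X Y 0 [], sigma_joint pen D X Y 1 [],
        sigma_joint pen D X Y 2 []) \<in> admissible_below D []"
      "R_triple pen X Y (sigma_joint pen D X Y 1 []) (sigma_joint pen D X Y 2 [])
        (sigma_joint pen D X Y 0 []) [] = V_joint pen D X Y []"
    using sigma_joint_attains_V_joint[of "[]" D pen X Y] by simp_all
  have bound: "R_triple pen X Y \<sigma>1 \<sigma>2 \<sigma>0 [] \<le> V_joint pen D X Y []"
    if "(\<sigma>0, \<sigma>1, \<sigma>2) \<in> admissible_below D []" for \<sigma>0 \<sigma>1 \<sigma>2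
    using R_triple_le_V_joint[OF _ that] by simp
  show "is_arg_max
      (\<lambda>(\<sigma>0, \<sigma>1, \<sigma>2). criterion pen X Y \<sigma>0 \<sigma>1 \<sigma>2)
      (\<lambda>(\<sigma>0, \<sigma>1, \<sigma>2). admissible \<sigma>0 \<sigma>1 \<sigma>2 \<and> (\<forall>u \<in> \<sigma>0 \<union> \<sigma>1 \<union> \<sigma>2. length u \<le> D))
      (sigma_joint pen D X Y 0 [], sigma_joint pen D X Y 1 [], sigma_joint pen D X Y 2 [])"
    unfolding is_arg_max_def below_root criterion_eq_R_triple
    using attains bound by (auto simp: not_less)
qed

end
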